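(* Let $f:\mathbb{R}^n\to\mathbb{R}$ be twice continuously differentiable and let $a\in\mathbb{R}^n$ with $a>0$ entrywise. Consider the problem $(\mathrm{C_3})$ of minimizing $f(x)$ over the weighted probability simplex $\Delta_n^a=\{x\in\mathbb{R}^n:\sum_{i=1}^n[a]_i[x]_i=1,\ [x]_i\ge0\ \forall i\}$, and the problem $(\mathrm{NC_3})$ of minimizing $f(z\odot z)$ over $\mathcal{B}_n^a=\{z\in\mathbb{R}^n:\sum_{i=1}^n[a]_i[z]_i^2=1\}$. Then: 1. If $x^\star$ is a second-order KKT point of $(\mathrm{C_3})$, then every $z^\star\in\mathbb{R}^n$ with $z^\star\odot z^\star=x^\star$ is a second-order KKT point of $(\mathrm{NC_3})$. 2. Conversely, if $z^\star$ is a second-order KKT point of $(\mathrm{NC_3})$, then $x^\star=z^\star\odot z^\star$ is a second-order KKT point of $(\mathrm{C_3})$.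
   Context: Notation: $[x]_i$ is the $i$th entry of $x$; $\odot$ is the entrywise product; vector inequalities are entrywise; $\|d\|^2_{\mathrm{diag}(a)}=\sum_i[a]_i[d]_i^2$. A point $x^\star$ is a second-order KKT point of $(\mathrm{C_3})$ if there exist $\lambda^\star\in\mathbb{R}$, $\beta^\star\in\mathbb{R}^n$ with $\nabla f(x^\star)=\lambda^\star a+\beta^\star$, $x^\star\ge0$, $\beta^\star\ge0$, $x^\star\odot\beta^\star=0$, $a^\top x^\star=1$; and $u^\top\nabla^2f(x^\star)u\ge0$ for all $u\in\mathbb{R}^n$ with $a^\top u=0$ and $[u]_k=0$ whenever $[x^\star]_k=0$. A point $z^\star$ is a second-order KKT point of $(\mathrm{NC_3})$ if there exists $\lambda_N^\star\in\mathbb{R}$ with $\nabla f(z^\star\odot z^\star)\odot z^\star=\lambda_N^\star\,a\odot z^\star$, $\|z^\star\|^2_{\mathrm{diag}(a)}=1$, and $$4(z^\star\odot d)^\top\nabla^2f(z^\star\odot z^\star)(z^\star\odot d)+2\langle\nabla f(z^\star\odot z^\star),d\odot d\rangle-2\lambda_N^\star\|d\|_{\mathrm{diag}(a)}^2\ge0$$ for all $d\in\mathbb{R}^n$ with $d^\top\mathrm{diag}(a)z^\star=0$. *)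

theory Defs
  imports "HOL-Analysis.Analysis"
begin

(* On real ^ 'n the library orders and multiplies entrywise: x * y is the entrywise product,
   and 0 \<le> x means 0 \<le> x $ i for all i.  The strict order on vectors is NOT entrywise. *)

definition grad :: "(real ^ 'n \<Rightarrow> real) \<Rightarrow> real ^ 'n \<Rightarrow> real ^ 'n" where
  "grad f x = (THE g. GDERIV f x :> g)"

definition hessian :: "(real ^ 'n \<Rightarrow> real) \<Rightarrow> real ^ 'n \<Rightarrow> real ^ 'n ^ 'n" where
  "hessian f x = jacobian (grad f) (at x)"

definition twice_continuously_differentiable :: "(real ^ 'n \<Rightarrow> real) \<Rightarrow> bool" where
  "twice_continuously_differentiable f \<longleftrightarrow>
     (\<forall>x. f differentiable (at x)) \<and>
     (\<forall>x. grad f differentiable (at x)) \<and>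
     continuous_on UNIV (hessian f)"

lemma GDERIV_unique_grad:
  assumes "GDERIV f x :> g"
  shows "grad f x = g"
  unfolding grad_def
proof (rule the_equality)
  fix g' assume "GDERIV f x :> g'"
  then have "(\<lambda>h. h \<bullet> g') = (\<lambda>h. h \<bullet> g)"
    using assms has_derivative_unique unfolding gderiv_def by blast
  then show "g' = g"
    by (metis vector_eq_ldot)
qed (fact assms)

lemma grad_component:
  fixes f :: "real ^ 'n \<Rightarrow> real"
  assumes "f differentiable (at x)"
  shows "grad f x $ i = frechet_derivative f (at x) (axis i 1)"
proof -
  let ?D = "frechet_derivative f (at x)"
  have D: "(f has_derivative ?D) (at x)"
    using assms by (simp add: frechet_derivative_works)
  have "linear ?D"
    using D by (rule has_derivative_linear)
  then have "?D = (\<lambda>h. h \<bullet> adjoint ?D 1)"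
    using adjoint_works[of ?D _ 1] by (auto simp: fun_eq_iff)
  then have "GDERIV f x :> adjoint ?D 1" and *: "?D (axis i 1) = axis i 1 \<bullet> adjoint ?D 1"
    using D unfolding gderiv_def by metis+
  then show ?thesis
    by (simp add: GDERIV_unique_grad inner_axis')
qed

lemma hessian_component:
  fixes f :: "real ^ 'n \<Rightarrow> real"
  assumes "grad f differentiable (at x)"
  shows "hessian f x $ i $ j = frechet_derivative (\<lambda>y. grad f y $ i) (at x) (axis j 1)"
proof -
  have "(grad f has_derivative frechet_derivative (grad f) (at x)) (at x)"
    using assms by (simp add: frechet_derivative_works)
  then have "((\<lambda>y. grad f y $ i) has_derivative (\<lambda>h. frechet_derivative (grad f) (at x) h $ i)) (at x)"
    by (rule bounded_linear.has_derivative[OF bounded_linear_vec_nth])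
  then show ?thesis
    by (simp add: hessian_def jacobian_def matrix_def frechet_derivative_at[symmetric])
qed

definition weighted_simplex :: "real ^ 'n \<Rightarrow> (real ^ 'n) set" where
  "weighted_simplex a = {x. (\<Sum>i\<in>UNIV. a $ i * x $ i) = 1 \<and> (\<forall>i. 0 \<le> x $ i)}"

definition weighted_sphere :: "real ^ 'n \<Rightarrow> (real ^ 'n) set" where
  "weighted_sphere a = {z. (\<Sum>i\<in>UNIV. a $ i * (z $ i)\<^sup>2) = 1}"

definition diag :: "real ^ 'n \<Rightarrow> real ^ 'n ^ 'n" where
  "diag a = (\<chi> i j. if i = j then a $ i else 0)"

definition weighted_norm_sq :: "real ^ 'n \<Rightarrow> real ^ 'n \<Rightarrow> real" where
  "weighted_norm_sq a d = (\<Sum>i\<in>UNIV. a $ i * (d $ i)\<^sup>2)"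

(* Second-order KKT points of: minimize f x over x in weighted_simplex a. *)
definition simplex_second_order_KKT ::
  "(real ^ 'n \<Rightarrow> real) \<Rightarrow> real ^ 'n \<Rightarrow> real ^ 'n \<Rightarrow> bool" where
  "simplex_second_order_KKT f a x \<longleftrightarrow>
     (\<exists>(\<nu> :: real) (\<beta> :: real ^ 'n).
        grad f x = \<nu> *\<^sub>R a + \<beta> \<and> 0 \<le> x \<and> 0 \<le> \<beta> \<and> x * \<beta> = 0 \<and> a \<bullet> x = 1) \<and>
     (\<forall>u. a \<bullet> u = 0 \<and> (\<forall>k. x $ k = 0 \<longrightarrow> u $ k = 0) \<longrightarrow> 0 \<le> u \<bullet> (hessian f x *v u))"

(* Second-order KKT points of: minimize f (z * z) over z in weighted_sphere a. *)
definition sphere_second_order_KKT ::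
  "(real ^ 'n \<Rightarrow> real) \<Rightarrow> real ^ 'n \<Rightarrow> real ^ 'n \<Rightarrow> bool" where
  "sphere_second_order_KKT f a z \<longleftrightarrow>
     (\<exists>\<mu> :: real.
        grad f (z * z) * z = \<mu> *\<^sub>R (a * z) \<and>
        weighted_norm_sq a z = 1 \<and>
        (\<forall>d. d \<bullet> (diag a *v z) = 0 \<longrightarrow>
           0 \<le> 4 * ((z * d) \<bullet> (hessian f (z * z) *v (z * d)))
               + 2 * (grad f (z * z) \<bullet> (d * d))
               - 2 * \<mu> * weighted_norm_sq a d))"

lemma simplex_second_order_KKT_feasible:
  "simplex_second_order_KKT f a x \<Longrightarrow> x \<in> weighted_simplex a"
  by (auto simp: simplex_second_order_KKT_def weighted_simplex_def inner_vec_def less_eq_vec_def)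

lemma sphere_second_order_KKT_feasible:
  "sphere_second_order_KKT f a z \<Longrightarrow> z \<in> weighted_sphere a"
  by (auto simp: sphere_second_order_KKT_def weighted_sphere_def weighted_norm_sq_def)

end

theory Submission
  imports Defs
begin

text \<open>
  With $\beta = \nabla f(x) - \mu a$, the last two terms of the curvature condition on the sphere
  combine to $2 \langle \beta, d \odot d\rangle$.  The substitution $u = z \odot d$ turns directions
  tangent to the sphere into admissible directions on the simplex, and
  $\beta \odot z = 0$ makes the extra term depend on $d$ only off the support of $z$.  Testing with
  the unit vectors off the support gives $\beta \ge 0$; testing with $d = u / z$ on the support
  gives the condition on the Hessian.
\<close>

text \<open>Reads tangency of \<open>d\<close> to the sphere at \<open>z\<close> as tangency of
  \<open>z * d\<close> to the hyperplane containing the simplex.\<close>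

lemma inner_diag_mult: "d \<bullet> (diag a *v z) = a \<bullet> (z * d)"
proof -
  have "diag a *v z = a * z"
    by (simp add: vec_eq_iff diag_def matrix_vector_mult_def if_distrib[of "\<lambda>c. c * x" for x]
        cong: if_cong)
  then show ?thesis
    by (simp add: inner_vec_def mult_ac)
qed

lemma weighted_norm_sq_eq_inner: "weighted_norm_sq a d = a \<bullet> (d * d)"
  by (simp add: weighted_norm_sq_def inner_vec_def power2_eq_square)

text \<open>Gives both KKT notions the same multipliers, so that they can be passed across
  unchanged. The curvature inequality is halved.\<close>

lemma sphere_second_order_KKT_iff:
  "sphere_second_order_KKT f a z \<longleftrightarrow>
    (\<exists>\<mu> \<beta>. grad f (z * z) = \<mu> *\<^sub>R a + \<beta> \<and> \<beta> * z = 0 \<and> a \<bullet> (z * z) = 1 \<and>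
      (\<forall>d. a \<bullet> (z * d) = 0 \<longrightarrow>
        0 \<le> 2 * ((z * d) \<bullet> (hessian f (z * z) *v (z * d))) + \<beta> \<bullet> (d * d)))"
proof -
  \<comment> \<open>One-point rule: \<mu> determines \<beta>, so eliminating \<beta> leaves
    conditions on \<mu> alone on both sides.\<close>
  have shift: "(\<exists>\<beta>. g = \<mu> *\<^sub>R a + \<beta> \<and> P \<beta>) \<longleftrightarrow> P (g - \<mu> *\<^sub>R a)" for g \<mu> P
    by (metis add_diff_cancel_left' add.commute diff_add_cancel)
  have stationary: "g * z = \<mu> *\<^sub>R (a * z) \<longleftrightarrow> (g - \<mu> *\<^sub>R a) * z = 0" for g \<mu>
    by (simp add: vec_eq_iff algebra_simps)
  have curvature: "0 \<le> 4 * q + 2 * (g \<bullet> w) - 2 * \<mu> * (a \<bullet> w) \<longleftrightarrow>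
      0 \<le> 2 * q + (g - \<mu> *\<^sub>R a) \<bullet> w" for g \<mu> w q
    by (auto simp: inner_diff_left)
  show ?thesis
    unfolding sphere_second_order_KKT_def inner_diag_mult weighted_norm_sq_eq_inner
      shift stationary curvature ..
qed

lemma sphere_KKT_if_simplex_KKT:
  assumes "simplex_second_order_KKT f a (z * z)"
  shows "sphere_second_order_KKT f a z"
proof -
  obtain \<nu> \<beta> where grad: "grad f (z * z) = \<nu> *\<^sub>R a + \<beta>" and "0 \<le> \<beta>"
    and compl: "z * z * \<beta> = 0" and feas: "a \<bullet> (z * z) = 1"
    using assms unfolding simplex_second_order_KKT_def by blast
  have hess: "0 \<le> u \<bullet> (hessian f (z * z) *v u)"
    if "a \<bullet> u = 0" "\<And>k. z $ k = 0 \<Longrightarrow> u $ k = 0" for u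
    using assms that unfolding simplex_second_order_KKT_def by simp
  have "\<beta> * z = 0"
    using compl by (auto simp: vec_eq_iff)
  moreover have "0 \<le> 2 * ((z * d) \<bullet> (hessian f (z * z) *v (z * d))) + \<beta> \<bullet> (d * d)"
    if "a \<bullet> (z * d) = 0" for d
  proof -
    have "0 \<le> \<beta> \<bullet> (d * d)"
      using \<open>0 \<le> \<beta>\<close> by (auto simp: inner_vec_def less_eq_vec_def intro!: sum_nonneg)
    \<comment> \<open>The vector \<open>z * d\<close> vanishes wherever \<open>z\<close> does, hence
      is an admissible direction on the simplex.\<close>
    then show ?thesis
      using hess[of "z * d"] that by simp
  qed
  ultimately show ?thesis
    unfolding sphere_second_order_KKT_iff using grad feas by blast
qed

lemma simplex_KKT_if_sphere_KKT:
  assumes "sphere_second_order_KKT f a z"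
  shows "simplex_second_order_KKT f a (z * z)"
proof -
  obtain \<mu> \<beta> where grad: "grad f (z * z) = \<mu> *\<^sub>R a + \<beta>"
    and compl: "\<beta> * z = 0" and feas: "a \<bullet> (z * z) = 1"
    and curv: "\<And>d. a \<bullet> (z * d) = 0 \<Longrightarrow>
      0 \<le> 2 * ((z * d) \<bullet> (hessian f (z * z) *v (z * d))) + \<beta> \<bullet> (d * d)"
    using assms unfolding sphere_second_order_KKT_iff by blast
  have compl_nth: "\<beta> $ i = 0 \<or> z $ i = 0" for i
    using compl by (auto simp: vec_eq_iff)
  have "0 \<le> \<beta> $ i" for i
  proof (cases "z $ i = 0")
    case True
    \<comment> \<open>For this direction the tangency condition is trivial and the Hessian term
      vanishes, so \<open>curv\<close> reduces to the sign of \<open>\<beta> $ i\<close>.\<close>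
    have "z * axis i 1 = 0" and "axis i 1 * axis i 1 = (axis i 1 :: real ^ 'a)"
      using True by (auto simp: vec_eq_iff axis_def)
    then show ?thesis
      using curv[of "axis i 1"] by (simp add: inner_axis)
  qed (use compl_nth[of i] in simp)
  then have "0 \<le> \<beta>"
    by (simp add: less_eq_vec_def)
  moreover have "0 \<le> z * z"
    by (simp add: less_eq_vec_def)
  moreover have "z * z * \<beta> = 0"
    using compl_nth by (auto simp: vec_eq_iff)
  moreover have "0 \<le> u \<bullet> (hessian f (z * z) *v u)"
    if "a \<bullet> u = 0" and supp: "\<forall>k. (z * z) $ k = 0 \<longrightarrow> u $ k = 0" for u
  proof -
    \<comment> \<open>Off the support of \<open>z\<close> this is \<open>0 / 0 = 0\<close>.\<close>
    define d where "d = (\<chi> i. u $ i / z $ i)"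
    have "z * d = u"
      using supp by (auto simp: vec_eq_iff d_def)
    \<comment> \<open>On the support of \<open>z\<close> complementarity kills \<beta>; off it
      \<open>d\<close> is zero.\<close>
    moreover have "\<beta> \<bullet> (d * d) = 0"
      unfolding inner_vec_def d_def using compl_nth by (intro sum.neutral) force
    ultimately show ?thesis
      using curv[of d] that by simp
  qed
  ultimately show ?thesis
    unfolding simplex_second_order_KKT_def using grad feas by blast
qed

theorem theorem8:
  fixes f :: "real ^ 'n \<Rightarrow> real" and a :: "real ^ 'n"
  assumes "twice_continuously_differentiable f"
    and "\<forall>i. 0 < a $ i"
  shows "(\<forall>x. simplex_second_order_KKT f a x \<longrightarrow>
            (\<forall>z. z * z = x \<longrightarrow> sphere_second_order_KKT f a z)) \<and>
         (\<forall>z. sphere_second_order_KKT f a z \<longrightarrow> simplex_second_order_KKT f a (z * z))"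
  using sphere_KKT_if_simplex_KKT simplex_KKT_if_sphere_KKT by blast

end
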